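(* Let $f$ be a Dalang-admissible correlation function and let $\rho$ be an admissible diffusion coefficient with constant $M_0\ge0$ (see context). Let $u(t,x)$ be a solution to the stochastic heat equation with initial condition $\mu\equiv1$. Then for all $t\ge1$, $x\in\mathbb{R}^d$ and $z\ge L_t$, $$\mathbb{P}\big(|u(t,x)|\ge z\big)\le\exp\Big(-(C_*h(t))^{-1}F\big(z^2/(C_*e^2)\big)\Big),$$ where $$L_t:=e\sqrt{2C_*M^2+C_*F^{-1}\big(2C_*h(t)\big)}$$ and the constant $C_*>0$ is the same as in the moment bound $$\|u(t,x)\|_p^2\le C_*F^{-1}\big(C_*\,p\,h(t)\big),\qquad(t,x,p)\in[1,\infty)\times\mathbb{R}^d\times[2,\infty).$$
   Context: Fix $d\ge1$; $\|X\|_p=(\mathbb{E}|X|^p)^{1/p}$; $p_t(x)=(2\pi t)^{-d/2}e^{-|x|^2/(2t)}$; $e$ is Euler's number; $\exp(-\infty)=0$. **Equation.** $\dot W$ is a centered Gaussian noise with $\mathbb{E}[\dot W(t,x)\dot W(s,y)]=\delta_0(t-s)f(x-y)$. The stochastic heat equation is $\partial_t u=\frac12\Delta u+\rho(u)\dot W$ on $t>0,\ x\in\mathbb{R}^d$, $u(0,\cdot)=\mu$. A solution is a mild solution: $u(t,x)=(p_t*\mu)(x)+\int_0^t\int_{\mathbb{R}^d}p_{t-s}(x-y)\rho(u(s,y))\,W(ds,dy)$, with the stochastic integral in the sense of Walsh–Dalang. **Dalang-admissible $f$:** $f$ is a nonnegative, nonnegative-definite (generalized) function on $\mathbb{R}^d$,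 not identically zero, with $\int_{\mathbb{R}^d}\frac{\widehat f(d\xi)}{1+|\xi|^2}<\infty$, where $\widehat f(\xi)=\int f(x)e^{-ix\cdot\xi}dx$. Set $h(t)=\int_0^t ds\iint_{\mathbb{R}^{2d}}p_s(y)p_s(y')f(y-y')\,dy\,dy'$. **Admissible $\rho$ with constant $M_0$:** $\rho:\mathbb{R}\to\mathbb{R}$ is locally bounded; $\lim_{x\to\pm\infty}\rho(x)/x=0$; and $M_0\ge0$ is a constant such that $|\rho|$ is concave separately on $(-\infty,-M_0]$ and on $[M_0,\infty)$. **$M$, $F$, $F^{-1}$.** For $p>0$, $x\ge0$ put $\rho_p^{\pm}(x)=|\rho(\pm x^{1/p})|^p$ and $\rho_p=\rho_p^++\rho_p^-$. $M\ge M_0$ is a constant, independent of $p$, such that for all $p>0$ the functions $\rho_p,\rho_p^+,\rho_p^-$ are concave on $[M^p,\infty)$. $F:[M^2,\infty)\to[0,\infty]$ is $F(x)=\frac{x}{4\rho_2(x)}$, with $x/0:=\infty$ for $x>0$ and $F(0):=\lim_{x\downarrow0}\frac{x}{4\rho_2(x)}$ if $M=0$ and $\rho_2(0)=0$. Its right inverse is $F^{-1}(x)=\inf\{y\in[2M^2,\infty):F(y)\ge x\}$. **About $C_*$.** The source obtains the moment bound with constant $C_*$ (for bounded initial conditions) in a separate theorem, there for $\rho$ not identically zero on $(-\infty,-M_0]\cup[M_0,\infty)$; the present theorem does not list that condition among its hypotheses. *)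

theory Defs
  imports "HOL-Probability.Probability"
begin

section \<open>Heat kernel and Schwartz functions\<close>

definition heat_kernel :: "real \<Rightarrow> 'a::euclidean_space \<Rightarrow> real" where
  "heat_kernel t x =
     (2 * pi * t) powr (- (real DIM('a) / 2)) * exp (- ((norm x)\<^sup>2 / (2 * t)))"

primrec iter_deriv ::
  "'a list \<Rightarrow> ('a::euclidean_space \<Rightarrow> complex) \<Rightarrow> 'a \<Rightarrow> complex" where
  "iter_deriv [] \<phi> = \<phi>"
| "iter_deriv (b # bs) \<phi> = (\<lambda>x. frechet_derivative (iter_deriv bs \<phi>) (at x) b)"

definition schwartz :: "('a::euclidean_space \<Rightarrow> complex) \<Rightarrow> bool" where
  "schwartz \<phi> \<longleftrightarrow>
     (\<forall>bs. set bs \<subseteq> Basis \<longrightarrow>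
        iter_deriv bs \<phi> differentiable_on UNIV \<and>
        (\<forall>k::nat. bounded (range (\<lambda>x. (norm x ^ k) *\<^sub>R iter_deriv bs \<phi> x))))"

definition fourier :: "('a::euclidean_space \<Rightarrow> complex) \<Rightarrow> 'a \<Rightarrow> complex" where
  "fourier \<phi> \<xi> = (LINT x|lborel. \<phi> x * cis (- (x \<bullet> \<xi>)))"

section \<open>Correlation functions\<close>

text \<open>
  A nonnegative generalized function is a positive tempered Borel measure. So
  a correlation function is a measure \<open>f\<close>, with \<open>f(z) dz\<close> read as \<open>f(dz)\<close>;
  an ordinary function is the measure with that density.
\<close>

definition tempered :: "'a::euclidean_space measure \<Rightarrow> bool" where
  "tempered f \<longleftrightarrow> sets f = sets borel \<and>
     (\<exists>k::nat. (\<integral>\<^sup>+x. ennreal (1 / (1 + norm x) ^ k) \<partial>f) < \<infinity>)"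

text \<open>
  \<open>\<langle>f, \<phi> * \<phi>~\<rangle> \<ge> 0\<close> for all Schwartz \<open>\<phi>\<close>, where \<open>\<phi>~(x)\<close> is the conjugate of \<open>\<phi>(-x)\<close>.
\<close>

definition nonneg_definite :: "'a::euclidean_space measure \<Rightarrow> bool" where
  "nonneg_definite f \<longleftrightarrow>
     (\<forall>\<phi>. schwartz \<phi> \<longrightarrow>
        (LINT z|f. (LINT x|lborel. \<phi> x * cnj (\<phi> (x - z)))) \<in> \<real>\<^sub>\<ge>\<^sub>0)"

text \<open>
  \<open>S\<close> is the Fourier transform of \<open>f\<close> in the sense of tempered distributions, with the
  convention that the transform of \<open>f\<close> at \<open>\<xi>\<close> is \<open>\<integral> f(x) exp(-i x \<bullet> \<xi>) dx\<close>.
\<close>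

definition is_fourier_transform ::
  "'a::euclidean_space measure \<Rightarrow> 'a measure \<Rightarrow> bool" where
  "is_fourier_transform f S \<longleftrightarrow> tempered S \<and>
     (\<forall>\<phi>. schwartz \<phi> \<longrightarrow> (LINT x|f. fourier \<phi> x) = (LINT \<xi>|S. \<phi> \<xi>))"

definition dalang_admissible :: "'a::euclidean_space measure \<Rightarrow> bool" where
  "dalang_admissible f \<longleftrightarrow>
     tempered f \<and> nonneg_definite f \<and> emeasure f UNIV \<noteq> 0 \<and>
     (\<exists>S. is_fourier_transform f S \<and>
        (\<integral>\<^sup>+\<xi>. ennreal (1 / (1 + (norm \<xi>)\<^sup>2)) \<partial>S) < \<infinity>)"

text \<open>
  \<open>\<integral>\<integral> \<phi>(x) \<psi>(y) f(x - y) dx dy\<close> for nonnegative \<open>\<phi>\<close>, \<open>\<psi>\<close>, after substituting \<open>y = x - z\<close>.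
\<close>

definition corr_form ::
  "'a::euclidean_space measure \<Rightarrow> ('a \<Rightarrow> ennreal) \<Rightarrow> ('a \<Rightarrow> ennreal) \<Rightarrow> ennreal" where
  "corr_form f \<phi> \<psi> = (\<integral>\<^sup>+x. (\<integral>\<^sup>+z. \<phi> x * \<psi> (x - z) \<partial>f) \<partial>lborel)"

text \<open>For Dalang-admissible \<open>f\<close> the integral below is finite.\<close>

definition hfun :: "'a::euclidean_space measure \<Rightarrow> real \<Rightarrow> real" where
  "hfun f t = enn2real (\<integral>\<^sup>+s\<in>{0<..t}.
     corr_form f (\<lambda>y. ennreal (heat_kernel s y)) (\<lambda>y. ennreal (heat_kernel s y)) \<partial>lborel)"

section \<open>The diffusion coefficient\<close>

definition admissible_coeff :: "(real \<Rightarrow> real) \<Rightarrow> real \<Rightarrow> bool" where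
  "admissible_coeff \<rho> M0 \<longleftrightarrow>
     (\<forall>K. compact K \<longrightarrow> bounded (\<rho> ` K)) \<and>
     ((\<lambda>x. \<rho> x / x) \<longlongrightarrow> 0) at_top \<and> ((\<lambda>x. \<rho> x / x) \<longlongrightarrow> 0) at_bot \<and>
     M0 \<ge> 0 \<and>
     concave_on {..- M0} (\<lambda>x. \<bar>\<rho> x\<bar>) \<and> concave_on {M0..} (\<lambda>x. \<bar>\<rho> x\<bar>)"

definition rho_plus :: "(real \<Rightarrow> real) \<Rightarrow> real \<Rightarrow> real \<Rightarrow> real" where
  "rho_plus \<rho> p x = \<bar>\<rho> (x powr (1 / p))\<bar> powr p"

definition rho_minus :: "(real \<Rightarrow> real) \<Rightarrow> real \<Rightarrow> real \<Rightarrow> real" where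
  "rho_minus \<rho> p x = \<bar>\<rho> (- (x powr (1 / p)))\<bar> powr p"

definition rho_pow :: "(real \<Rightarrow> real) \<Rightarrow> real \<Rightarrow> real \<Rightarrow> real" where
  "rho_pow \<rho> p x = rho_plus \<rho> p x + rho_minus \<rho> p x"

definition concavity_constant :: "(real \<Rightarrow> real) \<Rightarrow> real \<Rightarrow> real \<Rightarrow> bool" where
  "concavity_constant \<rho> M0 M \<longleftrightarrow> M \<ge> M0 \<and>
     (\<forall>p>0. concave_on {M powr p..} (rho_pow \<rho> p) \<and>
            concave_on {M powr p..} (rho_plus \<rho> p) \<and>
            concave_on {M powr p..} (rho_minus \<rho> p))"

text \<open>
  In \<^typ>\<open>ennreal\<close>, \<open>x / 0 = \<infinity>\<close> for \<open>x > 0\<close>. Only the values on \<open>[M\<^sup>2, \<infinity>)\<close> are meant, so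
  the first branch matters only if \<open>M = 0\<close>; the limit then exists by concavity.
\<close>

definition Ffun :: "(real \<Rightarrow> real) \<Rightarrow> real \<Rightarrow> ennreal" where
  "Ffun \<rho> x =
     (if x = 0 \<and> rho_pow \<rho> 2 0 = 0
      then Lim (at_right 0) (\<lambda>y. ennreal y / ennreal (4 * rho_pow \<rho> 2 y))
      else ennreal x / ennreal (4 * rho_pow \<rho> 2 x))"

text \<open>The set is nonempty because \<open>\<rho>(x) / x\<close> tends to \<open>0\<close> at both infinities.\<close>

definition Finv :: "(real \<Rightarrow> real) \<Rightarrow> real \<Rightarrow> real \<Rightarrow> real" where
  "Finv \<rho> M x = Inf {y. y \<ge> 2 * M\<^sup>2 \<and> Ffun \<rho> y \<ge> ennreal x}"

section \<open>The noise\<close>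

text \<open>
  The noise is a set-indexed process \<open>W(B)\<close>, formally the integral of the noise
  over a bounded Borel subset \<open>B\<close> of \<open>[0, \<infinity>) \<times> \<real>\<^sup>d\<close>.
\<close>

definition bounded_borel :: "(real \<times> 'a::euclidean_space) set set" where
  "bounded_borel = {B \<in> sets borel. bounded B \<and> B \<subseteq> {0..} \<times> UNIV}"

definition noise_cov ::
  "'a::euclidean_space measure \<Rightarrow> (real \<times> 'a) set \<Rightarrow> (real \<times> 'a) set \<Rightarrow> ennreal" where
  "noise_cov f A B = (\<integral>\<^sup>+s\<in>{0..}.
     corr_form f (\<lambda>x. indicator A (s, x)) (\<lambda>y. indicator B (s, y)) \<partial>lborel)"

definition centered_gaussian :: "'w measure \<Rightarrow> ('w \<Rightarrow> real) \<Rightarrow> bool" where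
  "centered_gaussian P X \<longleftrightarrow> X \<in> borel_measurable P \<and>
     ((AE \<omega> in P. X \<omega> = 0) \<or>
      (\<exists>\<sigma>>0. distributed P lborel X (\<lambda>x. ennreal (normal_density 0 \<sigma> x))))"

definition gaussian_noise ::
  "'w measure \<Rightarrow> 'a::euclidean_space measure \<Rightarrow> ((real \<times> 'a) set \<Rightarrow> 'w \<Rightarrow> real) \<Rightarrow> bool" where
  "gaussian_noise P f W \<longleftrightarrow>
     (\<forall>I c. finite I \<and> I \<subseteq> bounded_borel \<longrightarrow>
        centered_gaussian P (\<lambda>\<omega>. \<Sum>B\<in>I. c B * W B \<omega>)) \<and>
     (\<forall>A\<in>bounded_borel. \<forall>B\<in>bounded_borel.
        (LINT \<omega>|P. W A \<omega> * W B \<omega>) = enn2real (noise_cov f A B))"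

text \<open>
  Filtrations for which \<open>W\<close> is adapted with increments independent of the past, for example the
  one generated by \<open>W\<close>, augmented by null sets or not.
\<close>

definition noise_filtration ::
  "'w measure \<Rightarrow> ((real \<times> 'a::euclidean_space) set \<Rightarrow> 'w \<Rightarrow> real) \<Rightarrow>
   (real \<Rightarrow> 'w measure) \<Rightarrow> bool" where
  "noise_filtration P W \<F> \<longleftrightarrow>
     (\<forall>t\<ge>0. subalgebra P (\<F> t)) \<and>
     (\<forall>s t. 0 \<le> s \<and> s \<le> t \<longrightarrow> sets (\<F> s) \<subseteq> sets (\<F> t)) \<and>
     (\<forall>t\<ge>0. \<forall>B\<in>bounded_borel. B \<subseteq> {0..t} \<times> UNIV \<longrightarrow> W B \<in> borel_measurable (\<F> t)) \<and>
     (\<forall>t\<ge>0. prob_space.indep_set P (sets (\<F> t))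
        (sigma_sets (space P)
           {W B -` S \<inter> space P | B S.
              B \<in> bounded_borel \<and> B \<subseteq> {t<..} \<times> UNIV \<and> S \<in> sets borel}))"

section \<open>Walsh--Dalang stochastic integral\<close>

text \<open>
  The entry \<open>(X, a, b, A)\<close> stands for the elementary process
  \<open>X(\<omega>) 1\<^bsub>(a,b]\<^esub>(s) 1\<^bsub>A\<^esub>(y)\<close>, a list for the sum of its entries.
\<close>

type_synonym ('w, 'a) simple_process = "(('w \<Rightarrow> real) \<times> real \<times> real \<times> 'a set) list"

definition is_simple ::
  "'w measure \<Rightarrow> (real \<Rightarrow> 'w measure) \<Rightarrow> ('w, 'a::euclidean_space) simple_process \<Rightarrow> bool" where
  "is_simple P \<F> es \<longleftrightarrow>
     (\<forall>(X, a, b, A) \<in> set es.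
        0 \<le> a \<and> a < b \<and> X \<in> borel_measurable (\<F> a) \<and> bounded (X ` space P) \<and>
        A \<in> sets borel \<and> bounded A)"

definition simple_value ::
  "('w, 'a::euclidean_space) simple_process \<Rightarrow> real \<Rightarrow> 'a \<Rightarrow> 'w \<Rightarrow> real" where
  "simple_value es s y \<omega> =
     (\<Sum>(X, a, b, A)\<leftarrow>es. X \<omega> * indicator {a<..b} s * indicator A y)"

definition simple_integral ::
  "((real \<times> 'a::euclidean_space) set \<Rightarrow> 'w \<Rightarrow> real) \<Rightarrow> ('w, 'a) simple_process \<Rightarrow> 'w \<Rightarrow> real" where
  "simple_integral W es \<omega> = (\<Sum>(X, a, b, A)\<leftarrow>es. X \<omega> * W ({a<..b} \<times> A) \<omega>)"

text \<open>The square of Walsh's norm, \<open>E \<integral> ds \<integral>\<integral> |\<Phi>(s,x) \<Phi>(s,y)| f(x - y) dx dy\<close>.\<close>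

definition walsh_norm_sq ::
  "'w measure \<Rightarrow> 'a::euclidean_space measure \<Rightarrow> (real \<Rightarrow> 'a \<Rightarrow> 'w \<Rightarrow> real) \<Rightarrow> ennreal" where
  "walsh_norm_sq P f \<Phi> =
     (\<integral>\<^sup>+\<omega>. (\<integral>\<^sup>+s\<in>{0<..}.
        corr_form f (\<lambda>x. ennreal \<bar>\<Phi> s x \<omega>\<bar>) (\<lambda>y. ennreal \<bar>\<Phi> s y \<omega>\<bar>) \<partial>lborel) \<partial>P)"

text \<open>
  \<open>Y\<close> is (a version of) the integral of \<open>\<Phi>\<close> over \<open>(0, \<infinity>) \<times> \<real>\<^sup>d\<close>. The integrands are the
  jointly measurable processes in the closure of the simple processes under Walsh's norm;
  they include all predictable processes of finite norm.
\<close>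

definition has_walsh_integral ::
  "'w measure \<Rightarrow> 'a::euclidean_space measure \<Rightarrow> ((real \<times> 'a) set \<Rightarrow> 'w \<Rightarrow> real) \<Rightarrow>
   (real \<Rightarrow> 'w measure) \<Rightarrow> (real \<Rightarrow> 'a \<Rightarrow> 'w \<Rightarrow> real) \<Rightarrow> ('w \<Rightarrow> real) \<Rightarrow> bool" where
  "has_walsh_integral P f W \<F> \<Phi> Y \<longleftrightarrow>
     (\<lambda>(s, y, \<omega>). \<Phi> s y \<omega>) \<in> borel_measurable (restrict_space borel {0<..} \<Otimes>\<^sub>M borel \<Otimes>\<^sub>M P) \<and>
     Y \<in> borel_measurable P \<and>
     (\<exists>es. (\<forall>n::nat. is_simple P \<F> (es n)) \<and>
        (\<lambda>n. walsh_norm_sq P f (\<lambda>s y \<omega>. \<Phi> s y \<omega> - simple_value (es n) s y \<omega>))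
           \<longlonglongrightarrow> 0 \<and>
        (\<lambda>n. \<integral>\<^sup>+\<omega>. ennreal ((Y \<omega> - simple_integral W (es n) \<omega>)\<^sup>2) \<partial>P) \<longlonglongrightarrow> 0)"

section \<open>Mild solutions\<close>

text \<open>The initial condition is a measure \<open>\<mu>\<close>; a function is identified with its density.\<close>

definition mild_solution ::
  "'w measure \<Rightarrow> 'a::euclidean_space measure \<Rightarrow> ((real \<times> 'a) set \<Rightarrow> 'w \<Rightarrow> real) \<Rightarrow>
   (real \<Rightarrow> 'w measure) \<Rightarrow> (real \<Rightarrow> real) \<Rightarrow> 'a measure \<Rightarrow>
   (real \<Rightarrow> 'a \<Rightarrow> 'w \<Rightarrow> real) \<Rightarrow> bool" where
  "mild_solution P f W \<F> \<rho> \<mu> u \<longleftrightarrow>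
     (\<lambda>(t, x, \<omega>). u t x \<omega>) \<in> borel_measurable (restrict_space borel {0<..} \<Otimes>\<^sub>M borel \<Otimes>\<^sub>M P) \<and>
     (\<forall>t>0. \<forall>x. u t x \<in> borel_measurable (\<F> t)) \<and>
     (\<forall>t>0. \<forall>x. \<exists>Y.
        has_walsh_integral P f W \<F>
          (\<lambda>s y \<omega>. if 0 < s \<and> s < t then heat_kernel (t - s) (x - y) * \<rho> (u s y \<omega>) else 0) Y \<and>
        (AE \<omega> in P. u t x \<omega> = (LINT y|\<mu>. heat_kernel t (x - y)) + Y \<omega>))"

section \<open>Moments and the tail bound\<close>

text \<open>\<open>(E |X|\<^sup>p)\<^bsup>1/p\<^esup>\<close>, equal to \<open>\<infinity>\<close> if \<open>X\<close> has no finite \<open>p\<close>-th moment.\<close>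

definition Lp_norm :: "'w measure \<Rightarrow> real \<Rightarrow> ('w \<Rightarrow> real) \<Rightarrow> ennreal" where
  "Lp_norm P p X =
     (let m = (\<integral>\<^sup>+\<omega>. ennreal (\<bar>X \<omega>\<bar> powr p) \<partial>P)
      in if m = \<infinity> then \<infinity> else ennreal (enn2real m powr (1 / p)))"

definition moment_bound ::
  "'w measure \<Rightarrow> 'a::euclidean_space measure \<Rightarrow> (real \<Rightarrow> real) \<Rightarrow> real \<Rightarrow>
   (real \<Rightarrow> 'a \<Rightarrow> 'w \<Rightarrow> real) \<Rightarrow> real \<Rightarrow> bool" where
  "moment_bound P f \<rho> M u C \<longleftrightarrow>
     (\<forall>t\<ge>1. \<forall>x. \<forall>p\<ge>2.
        (Lp_norm P p (u t x))\<^sup>2 \<le> ennreal (C * Finv \<rho> M (C * p * hfun f t)))"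

text \<open>\<open>exp(-a)\<close> with \<open>exp(-\<infinity>) = 0\<close>.\<close>

definition exp_neg :: "ennreal \<Rightarrow> real" where
  "exp_neg a = (if a = \<infinity> then 0 else exp (- enn2real a))"

definition tail_threshold ::
  "'a::euclidean_space measure \<Rightarrow> (real \<Rightarrow> real) \<Rightarrow> real \<Rightarrow> real \<Rightarrow> real \<Rightarrow> real" where
  "tail_threshold f \<rho> M C t =
     exp 1 * sqrt (2 * C * M\<^sup>2 + C * Finv \<rho> M (2 * C * hfun f t))"

end

theory Submission
  imports Defs
begin

text \<open>
  With \<open>y = z\<^sup>2 / (C e\<^sup>2)\<close>, apply Markov's inequality to the moment of order \<open>p = F(y) / (C h(t))\<close>,
  or to all large \<open>p\<close> if \<open>F(y) = \<infinity>\<close>: then \<open>F\<^sup>-\<^sup>1(C p h(t)) \<le> y\<close>, so the moment bound gives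
  \<open>\<parallel>u\<parallel>\<^sub>p \<le> z / e\<close> and the tail is at most \<open>exp(-p)\<close>. The moment bound needs \<open>p \<ge> 2\<close>, which follows
  from \<open>z \<ge> L\<^sub>t\<close> because \<open>F\<close> is nondecreasing: concavity of \<open>\<rho>\<^sub>p\<^sup>\<plusminus>\<close> for all \<open>p\<close> forces \<open>\<bar>\<rho>(x)\<bar> / \<bar>x\<bar>\<close>
  to decrease for \<open>\<bar>x\<bar> > M\<close> (let \<open>p \<rightarrow> \<infinity>\<close>). Markov's inequality fails for \<open>z = 0\<close>, but then
  \<open>F\<^sup>-\<^sup>1(2 C h(t)) = 0\<close>, so \<open>u(t,x) = 0\<close> almost surely, contradicting \<open>E u(t,x) = 1\<close>.
\<close>

section \<open>Concavity of all powers forces a decreasing ratio\<close>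

text \<open>For large \<open>p\<close> the point \<open>M powr p\<close> is negligible beside
  \<open>a powr p\<close>, so a chord starting there behaves like a chord from the origin, and
  concavity becomes monotonicity of the ratio. This is why \<open>a\<close> must lie strictly above
  \<open>M\<close>.\<close>

lemma ratio_antimono_if_powers_concave:
  fixes r :: "real \<Rightarrow> real"
  assumes conc: "\<And>p. p > 0 \<Longrightarrow> concave_on {M powr p..} (\<lambda>s. r (s powr (1 / p)) powr p)"
    and nonneg: "\<And>x. r x \<ge> 0"
    and "0 \<le> M" "M < a" "a \<le> b"
  shows "r b / b \<le> r a / a"
proof (rule ccontr)
  assume neg: "\<not> r b / b \<le> r a / a"
  have pos: "0 < a" "0 < b" using assms by auto
  have "a \<noteq> b" using neg by auto
  then have "a < b" using \<open>a \<le> b\<close> by simp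
  have rb: "r b > 0"
    using neg nonneg[of a] nonneg[of b] pos by (cases "r b = 0") (auto simp: less_le)
  \<comment> \<open>\<open>q\<close> is the quotient of the ratios at \<open>a\<close> and
    \<open>b\<close>, below 1 by the negated claim; \<open>d\<close> measures the error from
    starting the chord at \<open>M\<close> instead of 0.\<close>
  define q where "q = (r a * b) / (r b * a)"
  define d where "d = M / a"
  have q: "0 \<le> q" "q < 1"
    using neg nonneg[of a] rb pos by (auto simp: q_def field_simps)
  have d: "0 \<le> d" "d < 1"
    using assms pos by (auto simp: d_def)
  \<comment> \<open>Concavity between \<open>M\<^sup>p\<close> and \<open>b\<^sup>p\<close>, evaluated at \<open>a\<^sup>p\<close>, with the value at \<open>M\<^sup>p\<close> dropped.\<close>
  have lower: "1 \<le> q ^ Suc n + d ^ Suc n" for n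
  proof -
    define p where "p = real (Suc n)"
    have "p > 0" by (simp add: p_def)
    define g where "g = (\<lambda>s. r (s powr (1 / p)) powr p)"
    define \<alpha> \<beta> m where "\<alpha> = a powr p" and "\<beta> = b powr p" and "m = M powr p"
    have ord: "m < \<alpha>" "\<alpha> < \<beta>" "0 \<le> m"
      using assms \<open>a < b\<close> pos \<open>p > 0\<close> by (auto simp: \<alpha>_def \<beta>_def m_def intro!: powr_less_mono2)
    define \<tau> where "\<tau> = (\<alpha> - m) / (\<beta> - m)"
    have \<tau>: "0 \<le> \<tau>" "\<tau> \<le> 1" using ord by (auto simp: \<tau>_def)
    have g: "concave_on {m..} g" unfolding g_def m_def by (rule conc[OF \<open>p > 0\<close>])
    have "(1 - \<tau>) * g m + \<tau> * g \<beta> \<le> g ((1 - \<tau>) *\<^sub>R m + \<tau> *\<^sub>R \<beta>)"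
      using ord by (intro concave_onD[OF g \<tau>]) auto
    also have "(1 - \<tau>) *\<^sub>R m + \<tau> *\<^sub>R \<beta> = m + \<tau> * (\<beta> - m)" by (simp add: algebra_simps)
    also have "\<dots> = \<alpha>" using ord by (simp add: \<tau>_def)
    finally have "\<tau> * g \<beta> \<le> g \<alpha>"
      using \<tau> by (smt (verit) g_def mult_nonneg_nonneg powr_ge_zero)
    moreover have "g \<alpha> = r a powr p" "g \<beta> = r b powr p"
      using pos \<open>p > 0\<close> by (simp_all add: g_def \<alpha>_def \<beta>_def powr_powr)
    \<comment> \<open>With \<open>\<beta>\<close> in place of \<open>\<beta> - m\<close> the
      inequality becomes homogeneous: dividing it by \<open>\<alpha> * r b powr p\<close> leaves
      exactly the powers of \<open>q\<close> and \<open>d\<close>.\<close>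
    moreover have "(\<alpha> - m) / \<beta> \<le> \<tau>"
      unfolding \<tau>_def using ord by (intro divide_left_mono) (auto intro!: mult_pos_pos)
    ultimately have "(\<alpha> - m) / \<beta> * (r b powr p) \<le> r a powr p"
      by (smt (verit) mult_right_mono powr_ge_zero)
    then have "\<alpha> * (r b powr p) \<le> r a powr p * \<beta> + m * r b powr p"
      using ord by (simp add: field_simps)
    then have "a ^ Suc n * r b ^ Suc n \<le> r a ^ Suc n * b ^ Suc n + M ^ Suc n * r b ^ Suc n"
      unfolding \<alpha>_def \<beta>_def m_def p_def
      using pos rb nonneg[of a] \<open>0 \<le> M\<close> by (simp add: powr_realpow' del: power_Suc of_nat_Suc)
    then show ?thesis
      unfolding q_def d_def power_divide power_mult_distrib
      using pos rb by (simp add: field_simps del: power_Suc)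
  qed
  have "(\<lambda>n. q ^ Suc n + d ^ Suc n) \<longlonglongrightarrow> 0 + 0"
    using q d by (intro tendsto_add LIMSEQ_Suc LIMSEQ_power_zero) auto
  then have "1 \<le> (0::real)"
    using lower by (intro tendsto_lowerbound) (auto intro: always_eventually)
  then show False by simp
qed

lemma rho_pow_nonneg: "rho_pow \<rho> p x \<ge> 0"
  by (simp add: rho_pow_def rho_plus_def rho_minus_def)

lemma rho_pow_2_divide:
  assumes "x > 0"
  shows "rho_pow \<rho> 2 x / x =
    (\<bar>\<rho> (sqrt x)\<bar> / sqrt x)\<^sup>2 + (\<bar>\<rho> (- sqrt x)\<bar> / sqrt x)\<^sup>2"
  using assms
  by (simp add: rho_pow_def rho_plus_def rho_minus_def powr_half_sqrt power_divide
      add_divide_distrib)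

text \<open>Monotonicity of \<open>F\<close> in reciprocal form, which stays finite where
  \<open>rho_pow \<rho> 2\<close> vanishes. The two half-lines are treated separately at
  \<open>sqrt a\<close> and \<open>sqrt b\<close>, then squared and added.\<close>

lemma rho_pow_2_divide_antimono:
  assumes M: "concavity_constant \<rho> M0 M" "0 \<le> M" and ab: "M\<^sup>2 < a" "a \<le> b"
  shows "rho_pow \<rho> 2 b / b \<le> rho_pow \<rho> 2 a / a"
proof -
  have pos: "0 < a" "0 < b" using ab by (smt (verit) zero_le_power2)+
  have Ma: "M < sqrt a" using \<open>0 \<le> M\<close> ab(1) by (simp add: real_less_rsqrt)
  have "\<bar>\<rho> (sqrt b)\<bar> / sqrt b \<le> \<bar>\<rho> (sqrt a)\<bar> / sqrt a"
    using M Ma ab(2)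
    by (intro ratio_antimono_if_powers_concave[where r = "\<lambda>x. \<bar>\<rho> x\<bar>" and M = M])
       (auto simp: concavity_constant_def rho_plus_def[abs_def])
  moreover have "\<bar>\<rho> (- sqrt b)\<bar> / sqrt b \<le> \<bar>\<rho> (- sqrt a)\<bar> / sqrt a"
    using M Ma ab(2)
    by (intro ratio_antimono_if_powers_concave[where r = "\<lambda>x. \<bar>\<rho> (- x)\<bar>" and M = M])
       (auto simp: concavity_constant_def rho_minus_def[abs_def])
  ultimately show ?thesis
    unfolding rho_pow_2_divide[OF pos(1)] rho_pow_2_divide[OF pos(2)]
    using pos by (intro add_mono power_mono) auto
qed

section \<open>Level sets of \<open>F\<close> and its right inverse\<close>

text \<open>The form without division is a real inequality that also covers
  \<open>F = \<infinity>\<close>: if \<open>rho_pow \<rho> 2 x = 0\<close>, both sides hold.\<close>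

lemma ennreal_le_Ffun_iff:
  assumes "x > 0" "c \<ge> 0"
  shows "ennreal c \<le> Ffun \<rho> x \<longleftrightarrow> 4 * c * rho_pow \<rho> 2 x \<le> x"
proof (cases "rho_pow \<rho> 2 x = 0")
  case True
  then show ?thesis
    using assms by (simp add: Ffun_def ennreal_divide_zero)
next
  case False
  then have "rho_pow \<rho> 2 x > 0" using rho_pow_nonneg[of \<rho> 2 x] by simp
  then show ?thesis
    using assms by (simp add: Ffun_def divide_ennreal field_simps)
qed

text \<open>Sublinear growth of \<open>\<rho>\<close> at both infinities makes
  \<open>rho_pow \<rho> 2 x / x\<close> tend to 0, so \<open>F\<close> is eventually above any
  level. Hence the infimum in \<open>Finv\<close> is over a nonempty set.\<close>

lemma Ffun_level_set_nonempty:
  assumes "admissible_coeff \<rho> M0" "c \<ge> 0"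
  obtains y where "y \<ge> 2 * M\<^sup>2" "y > 0" "ennreal c \<le> Ffun \<rho> y"
proof -
  have top: "((\<lambda>x. \<rho> x / x) \<longlongrightarrow> 0) at_top" and bot: "((\<lambda>x. \<rho> x / x) \<longlongrightarrow> 0) at_bot"
    using assms by (auto simp: admissible_coeff_def)
  have s: "filterlim sqrt at_top at_top" by (rule sqrt_at_top)
  have s': "filterlim (\<lambda>x. - sqrt x) at_bot at_top"
    using s by (simp add: filterlim_uminus_at_bot)
  have "((\<lambda>x. (\<bar>\<rho> (sqrt x) / sqrt x\<bar>)\<^sup>2 + (\<bar>\<rho> (- sqrt x) / (- sqrt x)\<bar>)\<^sup>2) \<longlongrightarrow> \<bar>0\<bar>\<^sup>2 + \<bar>0\<bar>\<^sup>2) at_top"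
    by (intro tendsto_intros filterlim_compose[OF top s] filterlim_compose[OF bot s'])
  then have "((\<lambda>x. 4 * c * ((\<rho> (sqrt x) / sqrt x)\<^sup>2 + (\<rho> (- sqrt x) / sqrt x)\<^sup>2)) \<longlongrightarrow> 4 * c * 0) at_top"
    by (intro tendsto_mult tendsto_const) (simp add: power_divide)
  then have "\<forall>\<^sub>F x in at_top. 4 * c * ((\<rho> (sqrt x) / sqrt x)\<^sup>2 + (\<rho> (- sqrt x) / sqrt x)\<^sup>2) < 1"
    by (rule order_tendstoD(2)) simp
  then have "\<forall>\<^sub>F x in at_top. 4 * c * ((\<rho> (sqrt x) / sqrt x)\<^sup>2 + (\<rho> (- sqrt x) / sqrt x)\<^sup>2) < 1
      \<and> x > 0 \<and> x \<ge> 2 * M\<^sup>2"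
    by (intro eventually_conj eventually_gt_at_top eventually_ge_at_top)
  then obtain x where x: "4 * c * ((\<rho> (sqrt x) / sqrt x)\<^sup>2 + (\<rho> (- sqrt x) / sqrt x)\<^sup>2) < 1"
      "x > 0" "x \<ge> 2 * M\<^sup>2"
    using eventually_happens'[OF trivial_limit_at_top_linorder] by blast
  have "4 * c * (rho_pow \<rho> 2 x / x) \<le> 1"
    using x unfolding rho_pow_2_divide[OF x(2)] by (simp add: power_divide)
  then have "ennreal c \<le> Ffun \<rho> x"
    using x(2) assms(2) by (simp add: ennreal_le_Ffun_iff field_simps)
  then show thesis using that x by blast
qed

lemma Finv_ge:
  assumes "admissible_coeff \<rho> M0" "c \<ge> 0"
  shows "Finv \<rho> M c \<ge> 2 * M\<^sup>2"
  unfolding Finv_def using Ffun_level_set_nonempty[OF assms, of M]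
  by (intro cInf_greatest) blast+

lemma Finv_le:
  assumes "y \<ge> 2 * M\<^sup>2" "ennreal c \<le> Ffun \<rho> y"
  shows "Finv \<rho> M c \<le> y"
  unfolding Finv_def using assms by (intro cInf_lower bdd_belowI[of _ "2 * M\<^sup>2"]) auto

text \<open>Extends monotonicity to the endpoint 0, which belongs to the domain of \<open>F\<close>
  only for \<open>M = 0\<close>. If \<open>\<rho>\<close> vanishes there, \<open>F(0)\<close> is a
  right limit of a nondecreasing function, hence its infimum over positive arguments; otherwise
  \<open>F(0) = 0\<close>.\<close>

lemma Ffun_0_le:
  assumes "concavity_constant \<rho> M0 0" "0 < y"
  shows "Ffun \<rho> 0 \<le> Ffun \<rho> y"
proof (cases "rho_pow \<rho> 2 0 = 0")
  case True
  define G where "G = (\<lambda>x. ennreal x / ennreal (4 * rho_pow \<rho> 2 x))"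
  have F: "Ffun \<rho> x = G x" if "x > 0" for x using that by (simp add: Ffun_def G_def)
  have mono: "G a \<le> G b" if "0 < a" "a \<le> b" for a b
  proof (cases "rho_pow \<rho> 2 b = 0")
    case True
    then show ?thesis using that by (simp add: G_def ennreal_divide_zero)
  next
    case False
    have b: "rho_pow \<rho> 2 b > 0" using rho_pow_nonneg[of \<rho> 2 b] False by simp
    have le: "rho_pow \<rho> 2 b / b \<le> rho_pow \<rho> 2 a / a"
      using rho_pow_2_divide_antimono[OF assms(1), of a b] that by simp
    then have a: "rho_pow \<rho> 2 a > 0"
      using b that rho_pow_nonneg[of \<rho> 2 a] by (cases "rho_pow \<rho> 2 a = 0") (auto simp: field_simps)
    show ?thesis using a b that le
      by (simp add: G_def divide_ennreal field_simps)
  qed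
  have "(G \<longlongrightarrow> Inf (G ` ({0<..} \<inter> UNIV))) (at 0 within ({0<..} \<inter> UNIV))"
    by (rule Lim_right_bound[where K = 0]) (auto intro: mono)
  then have "Lim (at_right 0) G = Inf (G ` {0<..})"
    by (intro tendsto_Lim) auto
  then have "Ffun \<rho> 0 = Inf (G ` {0<..})"
    using True by (simp add: Ffun_def G_def)
  also have "\<dots> \<le> G y" using assms(2) by (intro INF_lower) simp
  finally show ?thesis using F[OF assms(2)] by simp
qed (simp add: Ffun_def)

text \<open>Each \<open>y' > y\<close> exceeds some point of the level set, so monotonicity gives
  \<open>F(y') \<ge> c\<close>. Letting \<open>y'\<close> decrease to \<open>y\<close> and using
  continuity of \<open>rho_pow \<rho> 2\<close> gives the claim at \<open>y\<close>, whether or not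
  the infimum is attained.\<close>

lemma le_Ffun_if_Finv_le:
  assumes adm: "admissible_coeff \<rho> M0" and M: "concavity_constant \<rho> M0 M" "0 \<le> M" and "0 \<le> c"
    and y: "y > 0" "y \<ge> 2 * M\<^sup>2" "Finv \<rho> M c \<le> y"
  shows "ennreal c \<le> Ffun \<rho> y"
proof -
  have yM: "M\<^sup>2 < y" using y by (cases "M = 0") (auto simp: less_le_trans[OF _ y(2)])
  have above: "4 * c * rho_pow \<rho> 2 y' \<le> y'" if "y < y'" for y'
  proof -
    define S where "S = {y. y \<ge> 2 * M\<^sup>2 \<and> ennreal c \<le> Ffun \<rho> y}"
    have "Inf S < y'"
      using y(3) that by (simp add: Finv_def S_def)
    moreover have "S \<noteq> {}"
      using Ffun_level_set_nonempty[OF adm \<open>0 \<le> c\<close>, of M] by (auto simp: S_def)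
    ultimately obtain v where "v \<in> S" "v < y'"
      using cInf_lessD by blast
    then have v: "v \<ge> 2 * M\<^sup>2" "ennreal c \<le> Ffun \<rho> v" "v < y'"
      by (auto simp: S_def)
    show ?thesis
    proof (cases "v = 0")
      case True
      then have "M = 0" using v(1) by simp
      then have "ennreal c \<le> Ffun \<rho> y'"
        using v(2) True Ffun_0_le[of \<rho> M0 y'] M y(1) that by auto
      then show ?thesis
        using ennreal_le_Ffun_iff[of y' c] y(1) that \<open>0 \<le> c\<close> by simp
    next
      case False
      then have "v > 0" using v(1) by (smt (verit) zero_le_power2)
      then have "M\<^sup>2 < v" using v(1) by (cases "M = 0") (auto simp: less_le_trans[OF _ v(1)])
      then have "rho_pow \<rho> 2 y' / y' \<le> rho_pow \<rho> 2 v / v"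
        using v(3) by (intro rho_pow_2_divide_antimono[OF M]) auto
      then have "4 * c * (rho_pow \<rho> 2 y' / y') \<le> 4 * c * (rho_pow \<rho> 2 v / v)"
        using \<open>0 \<le> c\<close> by (intro mult_left_mono) auto
      also have "\<dots> \<le> 1"
        using v(2) \<open>v > 0\<close> \<open>0 \<le> c\<close> by (simp add: ennreal_le_Ffun_iff)
      finally show ?thesis using y(1) that by (simp add: field_simps)
    qed
  qed
  \<comment> \<open>Concavity yields continuity only on the open half-line; \<open>yM\<close> places
    \<open>y\<close> inside it.\<close>
  have "concave_on {M powr 2..} (rho_pow \<rho> 2)"
    using M(1) unfolding concavity_constant_def by (metis zero_less_numeral)
  then have "convex_on {M\<^sup>2<..} (\<lambda>x. - rho_pow \<rho> 2 x)"
    unfolding concave_on_def using M by (auto intro: convex_on_subset)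
  then have "continuous_on {M\<^sup>2<..} (\<lambda>x. - (- rho_pow \<rho> 2 x))"
    by (intro continuous_on_minus convex_on_continuous) auto
  then have "isCont (rho_pow \<rho> 2) y"
    using yM by (simp add: continuous_on_eq_continuous_at)
  then have "(rho_pow \<rho> 2 \<longlongrightarrow> rho_pow \<rho> 2 y) (at_right y)"
    unfolding isCont_def by (rule tendsto_within_subset) simp
  then have "4 * c * rho_pow \<rho> 2 y \<le> y"
    using above
    by (intro tendsto_le[of "at_right y" "\<lambda>x. x" y "\<lambda>x. 4 * c * rho_pow \<rho> 2 x"] tendsto_intros)
       (auto simp: eventually_at_filter)
  then show ?thesis using y(1) \<open>0 \<le> c\<close> by (simp add: ennreal_le_Ffun_iff)
qed

section \<open>Mean-zero stochastic integrals and nondegeneracy of the solution\<close>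

text \<open>The kernel factorizes over the coordinates into one-dimensional normal densities of
  variance \<open>t\<close>.\<close>

lemma heat_kernel_integral:
  fixes x :: "'a::euclidean_space"
  assumes "t > 0"
  shows "(LINT y|lborel. heat_kernel t (x - y)) = 1"
proof -
  have norm_sq: "(norm v)\<^sup>2 = (\<Sum>b\<in>Basis. (v \<bullet> b)\<^sup>2)" for v :: 'a
    by (subst power2_norm_eq_inner, subst euclidean_inner) (simp add: power2_eq_square)
  have "(2 * pi * t) powr (- (real DIM('a) / 2)) = (1 / sqrt (2 * pi * (sqrt t)\<^sup>2)) ^ DIM('a)"
    using assms
    by (simp add: powr_half_sqrt[symmetric] powr_minus_divide[symmetric] powr_powr
        powr_realpow[symmetric] field_simps)
  then have kernel: "heat_kernel t (x - y) = (\<Prod>b\<in>Basis. normal_density (x \<bullet> b) (sqrt t) (y \<bullet> b))" for y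
    using assms
    by (simp add: heat_kernel_def normal_density_def prod.distrib norm_sq exp_sum[symmetric]
        sum_divide_distrib sum_negf[symmetric] inner_diff_left power2_commute prod_dividef power_divide)
  have "(\<integral>\<^sup>+y. ennreal (heat_kernel t (x - y)) \<partial>lborel)
      = (\<integral>\<^sup>+y. (\<Prod>b\<in>Basis. ennreal (normal_density (x \<bullet> b) (sqrt t) (y \<bullet> b))) \<partial>lborel)"
    by (simp add: kernel prod_ennreal)
  also have "\<dots> = (\<Prod>b\<in>Basis. \<integral>\<^sup>+v. ennreal (normal_density (x \<bullet> b) (sqrt t) v) \<partial>lborel)"
    by (rule nn_integral_lborel_prod) auto
  also have "\<dots> = 1"
    using assms by (intro prod.neutral ballI)
      (subst nn_integral_eq_integral; simp add: integrable_normal_density integral_normal_density)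
  finally show ?thesis
    by (subst integral_eq_nn_integral) (auto simp: kernel prod_nonneg)
qed

lemma centered_gaussian_expectation:
  assumes "prob_space P" "centered_gaussian P X"
  shows "integrable P X" "(LINT \<omega>|P. X \<omega>) = 0"
proof -
  interpret prob_space P by fact
  have "integrable P X \<and> (LINT \<omega>|P. X \<omega>) = 0"
  proof (cases "AE \<omega> in P. X \<omega> = 0")
    case True
    have "X \<in> borel_measurable P" using assms(2) by (simp add: centered_gaussian_def)
    then show ?thesis
      using True integrable_cong_AE[of X P "\<lambda>_. 0"] integral_cong_AE[of X P "\<lambda>_. 0"] by auto
  next
    case False
    then obtain \<sigma> where \<sigma>: "\<sigma> > 0" "distributed P lborel X (\<lambda>x. ennreal (normal_density 0 \<sigma> x))"
      using assms(2) by (auto simp: centered_gaussian_def)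
    have "integrable lborel (\<lambda>x. normal_density 0 \<sigma> x * x)"
      by (rule integrable_normal_moment_nz_1[OF \<sigma>(1)])
    then have "integrable P X"
      using distributed_integrable[OF \<sigma>(2), of "\<lambda>x. x"] by simp
    then show ?thesis
      using normal_distributed_expectation[OF \<sigma>] by simp
  qed
  then show "integrable P X" "(LINT \<omega>|P. X \<omega>) = 0" by auto
qed

lemma noise_expectation:
  assumes "prob_space P" "gaussian_noise P f W" "B \<in> bounded_borel"
  shows "integrable P (W B)" "(LINT \<omega>|P. W B \<omega>) = 0"
proof -
  have "\<forall>I c. finite I \<and> I \<subseteq> bounded_borel \<longrightarrow>
      centered_gaussian P (\<lambda>\<omega>. \<Sum>B\<in>I. c B * W B \<omega>)"
    using assms(2) by (simp add: gaussian_noise_def)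
  from this[rule_format, of "{B}" "\<lambda>_. 1"] have "centered_gaussian P (W B)"
    using assms(3) by simp
  then show "integrable P (W B)" "(LINT \<omega>|P. W B \<omega>) = 0"
    using centered_gaussian_expectation[OF assms(1)] by auto
qed

text \<open>The past up to time \<open>a\<close> is independent of the noise after \<open>a\<close>,
  so the expectation of the product factorizes, and the noise factor has mean 0.\<close>

lemma past_times_increment_expectation:
  assumes P: "prob_space P" and W: "gaussian_noise P f W" and \<F>: "noise_filtration P W \<F>"
    and a: "0 \<le> a" and X: "X \<in> borel_measurable (\<F> a)" "bounded (X ` space P)"
    and B: "B \<in> bounded_borel" "B \<subseteq> {a<..} \<times> UNIV"
  shows "integrable P (\<lambda>\<omega>. X \<omega> * W B \<omega>)" "(LINT \<omega>|P. X \<omega> * W B \<omega>) = 0"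
proof -
  interpret prob_space P by fact
  let ?T = "{W B -` S \<inter> space P | B S.
              B \<in> bounded_borel \<and> B \<subseteq> {a<..} \<times> UNIV \<and> S \<in> sets borel}"
  have sub: "subalgebra P (\<F> a)" using \<F> a by (auto simp: noise_filtration_def)
  then have sp: "space (\<F> a) = space P" by (simp add: subalgebra_def)
  have XP: "X \<in> borel_measurable P" using X(1) sub by (rule measurable_from_subalg[rotated])
  have WP: "integrable P (W B)" "(LINT \<omega>|P. W B \<omega>) = 0"
    using noise_expectation[OF P W B(1)] by auto
  have Xint: "integrable P X"
    using X(2) XP by (auto simp: bounded_iff intro!: integrable_const_bound AE_I2)
  have ind: "indep_set (sets (\<F> a)) (sigma_sets (space P) ?T)"
    using \<F> a by (auto simp: noise_filtration_def)
  \<comment> \<open>Independence is given for the full past and the full future noise; both are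
    shrunk to the sigma-algebras generated by \<open>X\<close> and \<open>W B\<close>.\<close>
  have "{X -` A \<inter> space P | A. A \<in> sets borel} \<subseteq> sets (\<F> a)"
    using measurable_sets[OF X(1)] by (auto simp: sp)
  then have 1: "sigma_sets (space P) {X -` A \<inter> space P | A. A \<in> sets borel} \<subseteq> sets (\<F> a)"
    using sets.sigma_sets_subset[of _ "\<F> a"] sp by simp
  have 2: "sigma_sets (space P) {W B -` A \<inter> space P | A. A \<in> sets borel} \<subseteq> sigma_sets (space P) ?T"
    using B by (intro sigma_sets_mono') blast
  have "indep_set (sigma_sets (space P) {X -` A \<inter> space P | A. A \<in> sets borel})
      (sigma_sets (space P) {W B -` A \<inter> space P | A. A \<in> sets borel})"
    using ind 1 2 unfolding indep_sets2_eq by blast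
  then have "indep_var borel X borel (W B)"
    unfolding indep_var_eq using XP WP(1) by auto
  then show "integrable P (\<lambda>\<omega>. X \<omega> * W B \<omega>)" "(LINT \<omega>|P. X \<omega> * W B \<omega>) = 0"
    using indep_var_lebesgue_integral[OF _ Xint WP(1)] indep_var_integrable[OF _ Xint WP(1)] WP(2)
    by auto
qed

lemma simple_integral_expectation:
  assumes P: "prob_space P" and W: "gaussian_noise P f W" and \<F>: "noise_filtration P W \<F>"
    and "is_simple P \<F> es"
  shows "integrable P (simple_integral W es)" "(LINT \<omega>|P. simple_integral W es \<omega>) = 0"
proof -
  have "integrable P (simple_integral W es) \<and> (LINT \<omega>|P. simple_integral W es \<omega>) = 0"
    using assms(4)
  proof (induction es)
    case Nil
    then show ?case by (simp add: simple_integral_def[abs_def])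
  next
    case (Cons e es)
    obtain X a b A where e: "e = (X, a, b, A)" by (cases e) auto
    have XA: "0 \<le> a" "X \<in> borel_measurable (\<F> a)" "bounded (X ` space P)" "A \<in> sets borel" "bounded A"
      using Cons.prems by (auto simp: is_simple_def e)
    have B: "{a<..b} \<times> A \<in> bounded_borel"
      using XA by (auto simp: bounded_borel_def intro!: borel_Times bounded_Times)
    have "integrable P (\<lambda>\<omega>. X \<omega> * W ({a<..b} \<times> A) \<omega>)" "(LINT \<omega>|P. X \<omega> * W ({a<..b} \<times> A) \<omega>) = 0"
      using past_times_increment_expectation[OF P W \<F> XA(1,2,3) B] by force+
    moreover have "integrable P (simple_integral W es)" "(LINT \<omega>|P. simple_integral W es \<omega>) = 0"
      using Cons by (auto simp: is_simple_def)
    moreover have "simple_integral W (e # es) = (\<lambda>\<omega>. X \<omega> * W ({a<..b} \<times> A) \<omega> + simple_integral W es \<omega>)"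
      by (simp add: e simple_integral_def[abs_def])
    ultimately show ?case by simp
  qed
  then show "integrable P (simple_integral W es)" "(LINT \<omega>|P. simple_integral W es \<omega>) = 0" by auto
qed

text \<open>The approximating simple integrals have mean 0, and a constant \<open>c\<close> has
  squared L2 distance at least \<open>c^2\<close> from every variable of mean 0.\<close>

lemma walsh_integral_AE_const_imp_0:
  assumes P: "prob_space P" and W: "gaussian_noise P f W" and \<F>: "noise_filtration P W \<F>"
    and Y: "has_walsh_integral P f W \<F> \<Phi> Y" "AE \<omega> in P. Y \<omega> = c"
  shows "c = 0"
proof -
  interpret prob_space P by fact
  obtain es where es: "\<And>n::nat. is_simple P \<F> (es n)"
    and lim: "(\<lambda>n. \<integral>\<^sup>+\<omega>. ennreal ((Y \<omega> - simple_integral W (es n) \<omega>)\<^sup>2) \<partial>P) \<longlonglongrightarrow> 0"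
    using Y(1) unfolding has_walsh_integral_def by blast
  \<comment> \<open>Integrate \<open>(c - S)\<^sup>2 \<ge> c\<^sup>2 - 2 c S\<close>, where \<open>S\<close> has mean \<open>0\<close>.\<close>
  have "ennreal (c\<^sup>2) \<le> (\<integral>\<^sup>+\<omega>. ennreal ((Y \<omega> - simple_integral W (es n) \<omega>)\<^sup>2) \<partial>P)" for n
  proof -
    let ?S = "simple_integral W (es n)"
    have S: "integrable P ?S" "(LINT \<omega>|P. ?S \<omega>) = 0"
      using simple_integral_expectation[OF P W \<F> es] by auto
    have int: "integrable P (\<lambda>\<omega>. c\<^sup>2 - 2 * c * ?S \<omega>)" using S by simp
    have "c\<^sup>2 = (LINT \<omega>|P. c\<^sup>2 - 2 * c * ?S \<omega>)" using S by (simp add: prob_space)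
    \<comment> \<open>The positive part allows passing to a nonnegative integral; it still lies
      below the square, which is itself nonnegative.\<close>
    also have "\<dots> \<le> (LINT \<omega>|P. max 0 (c\<^sup>2 - 2 * c * ?S \<omega>))"
      using int by (intro integral_mono) auto
    finally have "ennreal (c\<^sup>2) \<le> ennreal (LINT \<omega>|P. max 0 (c\<^sup>2 - 2 * c * ?S \<omega>))"
      by (rule ennreal_leI)
    also have "\<dots> = (\<integral>\<^sup>+\<omega>. ennreal (max 0 (c\<^sup>2 - 2 * c * ?S \<omega>)) \<partial>P)"
      using int by (intro nn_integral_eq_integral[symmetric]) auto
    also have "\<dots> \<le> (\<integral>\<^sup>+\<omega>. ennreal ((Y \<omega> - ?S \<omega>)\<^sup>2) \<partial>P)"
      using Y(2) by (intro nn_integral_mono_AE)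
        (auto intro!: ennreal_leI simp: power2_diff)
    finally show ?thesis .
  qed
  then have "ennreal (c\<^sup>2) \<le> 0"
    by (intro tendsto_lowerbound[OF lim]) auto
  then show ?thesis by simp
qed

text \<open>For initial condition 1 the deterministic part is 1, so a vanishing solution would make
  the stochastic integral equal to -1 almost surely.\<close>

lemma mild_solution_not_AE_0:
  fixes f :: "'a::euclidean_space measure"
  assumes P: "prob_space P" and W: "gaussian_noise P f W" and \<F>: "noise_filtration P W \<F>"
    and u: "mild_solution P f W \<F> \<rho> (density lborel (\<lambda>_. 1)) u" and t: "t > 0"
  shows "\<not> (AE \<omega> in P. u t x \<omega> = 0)"
proof
  assume 0: "AE \<omega> in P. u t x \<omega> = 0"
  obtain \<Phi> Y where Y: "has_walsh_integral P f W \<F> \<Phi> Y"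
      "AE \<omega> in P. u t x \<omega> = (LINT y|density lborel (\<lambda>_. 1). heat_kernel t (x - y)) + Y \<omega>"
    using u t unfolding mild_solution_def by blast
  have "AE \<omega> in P. Y \<omega> = -1"
    using 0 Y(2) by eventually_elim (simp add: density_1 heat_kernel_integral[OF t])
  then show False
    using walsh_integral_AE_const_imp_0[OF P W \<F> Y(1)] by fastforce
qed

section \<open>Markov's inequality and the tail bound\<close>

text \<open>With \<open>w = z / e\<close> bounding the norm, Markov's inequality for the
  \<open>p\<close>-th power gives \<open>(w / z) powr p\<close>, which is \<open>exp (- p)\<close>.
  This is where the factor \<open>e\<close> in the threshold comes from.\<close>

lemma tail_le_exp_neg_moment_order:
  assumes P: "prob_space P" and X: "X \<in> borel_measurable P" and "p \<ge> 2" "z > 0"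
    and L: "(Lp_norm P p X)\<^sup>2 \<le> ennreal ((z / exp 1)\<^sup>2)"
  shows "measure P {\<omega> \<in> space P. \<bar>X \<omega>\<bar> \<ge> z} \<le> exp (- p)"
proof -
  interpret prob_space P by fact
  define w where "w = z / exp 1"
  have w: "w > 0" using \<open>z > 0\<close> by (simp add: w_def)
  define m where "m = (\<integral>\<^sup>+\<omega>. ennreal (\<bar>X \<omega>\<bar> powr p) \<partial>P)"
  \<comment> \<open>An infinite moment would make the norm, and hence its square, infinite.\<close>
  have fin: "m \<noteq> \<infinity>"
    using L by (auto simp: Lp_norm_def m_def[symmetric] power2_eq_square ennreal_top_mult top_unique)
  have "(ennreal (enn2real m powr (1 / p)))\<^sup>2 \<le> ennreal (w\<^sup>2)"
    using L fin by (simp add: Lp_norm_def m_def[symmetric] w_def)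
  then have "(enn2real m powr (1 / p))\<^sup>2 \<le> w\<^sup>2"
    by (simp add: ennreal_power)
  then have "enn2real m powr (1 / p) \<le> w"
    using w by (simp add: power2_le_iff_abs_le)
  then have "(enn2real m powr (1 / p)) powr p \<le> w powr p"
    using \<open>p \<ge> 2\<close> by (intro powr_mono2) auto
  then have "enn2real m \<le> w powr p"
    using \<open>p \<ge> 2\<close> by (simp add: powr_powr)
  then have m: "m \<le> ennreal (w powr p)"
    using fin by (cases m) auto
  let ?A = "{\<omega> \<in> space P. \<bar>X \<omega>\<bar> \<ge> z}"
  have A: "?A \<in> sets P" using X by measurable
  have "ennreal (z powr p) * emeasure P ?A = (\<integral>\<^sup>+\<omega>. ennreal (z powr p) * indicator ?A \<omega> \<partial>P)"
    using A by (simp add: nn_integral_cmult_indicator)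
  also have "\<dots> \<le> m"
    unfolding m_def using \<open>p \<ge> 2\<close> \<open>z > 0\<close>
    by (intro nn_integral_mono) (auto simp: indicator_def intro!: ennreal_leI powr_mono2)
  also note m
  finally have "z powr p * prob ?A \<le> w powr p"
    by (simp add: emeasure_eq_measure ennreal_mult[symmetric])
  moreover have "w powr p = z powr p * exp (- p)"
    using \<open>z > 0\<close> by (simp add: w_def powr_def ln_div exp_add[symmetric] algebra_simps)
  ultimately show ?thesis using \<open>z > 0\<close> by simp
qed

lemma AE_eq_0_if_Lp_norm_0:
  assumes "X \<in> borel_measurable P" "(Lp_norm P p X)\<^sup>2 \<le> 0"
  shows "AE \<omega> in P. X \<omega> = 0"
proof -
  define m where "m = (\<integral>\<^sup>+\<omega>. ennreal (\<bar>X \<omega>\<bar> powr p) \<partial>P)"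
  have "m = 0"
    using assms(2) by (cases m) (auto simp: Lp_norm_def m_def[symmetric] split: if_splits)
  then have "AE \<omega> in P. ennreal (\<bar>X \<omega>\<bar> powr p) = 0"
    unfolding m_def using assms(1) by (subst (asm) nn_integral_0_iff_AE) auto
  then show ?thesis by eventually_elim simp
qed

theorem theorem1p5:
  fixes P :: "'w measure"
    and f :: "'a::euclidean_space measure"
    and W :: "(real \<times> 'a) set \<Rightarrow> 'w \<Rightarrow> real"
    and \<F> :: "real \<Rightarrow> 'w measure"
    and \<rho> :: "real \<Rightarrow> real"
    and M0 M C t z :: real
    and u :: "real \<Rightarrow> 'a \<Rightarrow> 'w \<Rightarrow> real"
    and x :: 'a
  assumes "prob_space P"
    and "dalang_admissible f"
    and "admissible_coeff \<rho> M0"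
    and "concavity_constant \<rho> M0 M"
    and "gaussian_noise P f W"
    and "noise_filtration P W \<F>"
    and "mild_solution P f W \<F> \<rho> (density lborel (\<lambda>_. 1)) u"
    and "C > 0"
    and "moment_bound P f \<rho> M u C"
    and "t \<ge> 1"
    and "z \<ge> tail_threshold f \<rho> M C t"
  shows "measure P {\<omega> \<in> space P. \<bar>u t x \<omega>\<bar> \<ge> z}
           \<le> exp_neg (ennreal (inverse (C * hfun f t)) * Ffun \<rho> (z\<^sup>2 / (C * (exp 1)\<^sup>2)))"
proof -
  interpret prob_space P by fact
  define h where "h = hfun f t"
  define y where "y = z\<^sup>2 / (C * (exp 1)\<^sup>2)"
  let ?p = "measure P {\<omega> \<in> space P. \<bar>u t x \<omega>\<bar> \<ge> z}"
  have "h \<ge> 0" by (simp add: h_def hfun_def)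
  have "M \<ge> 0" using assms(3,4) by (auto simp: admissible_coeff_def concavity_constant_def)
  have meas: "u t x \<in> borel_measurable P"
    using assms(6,7,10) unfolding mild_solution_def noise_filtration_def
    by (metis less_eq_real_def measurable_from_subalg zero_less_one_class.zero_less_one order_less_le_trans)
  have moment: "(Lp_norm P p (u t x))\<^sup>2 \<le> ennreal (C * Finv \<rho> M (C * p * h))" if "p \<ge> 2" for p
    using assms(9,10) that by (simp add: moment_bound_def h_def)
  have "?p \<le> exp_neg (ennreal (inverse (C * h)) * Ffun \<rho> y)"
  proof (cases "h = 0")
    case True \<comment> \<open>\<open>inverse 0 = 0\<close> makes the right-hand side \<open>1\<close>\<close>
    then show ?thesis by (simp add: exp_neg_def)
  next
    case False
    then have "h > 0" using \<open>h \<ge> 0\<close> by simp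
    define v where "v = Finv \<rho> M (2 * C * h)"
    have v: "v \<ge> 2 * M\<^sup>2"
      unfolding v_def using \<open>h > 0\<close> \<open>C > 0\<close> by (intro Finv_ge[OF assms(3)]) simp
    have "v \<ge> 0" using v by (smt (verit) zero_le_power2)
    have z: "z \<ge> exp 1 * sqrt (2 * C * M\<^sup>2 + C * v)"
      using assms(11) by (simp add: tail_threshold_def v_def h_def)
    have "z\<^sup>2 \<ge> (exp 1 * sqrt (2 * C * M\<^sup>2 + C * v))\<^sup>2"
      using z \<open>C > 0\<close> \<open>v \<ge> 0\<close> by (intro power_mono) auto
    then have "z\<^sup>2 \<ge> (exp 1)\<^sup>2 * (C * (2 * M\<^sup>2 + v))"
      using \<open>C > 0\<close> \<open>v \<ge> 0\<close> by (simp add: power_mult_distrib algebra_simps)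
    then have yv: "y \<ge> 2 * M\<^sup>2 + v"
      using \<open>C > 0\<close> by (simp add: y_def field_simps)
    have "z \<ge> 0"
      using z \<open>C > 0\<close> \<open>v \<ge> 0\<close> by (smt (verit) exp_gt_zero mult_nonneg_nonneg real_sqrt_ge_zero zero_le_power2)
    \<comment> \<open>For \<open>z = 0\<close> also \<open>y = 0\<close>, which squeezes
      \<open>v\<close> to 0; the moment bound of order 2, with right-hand side \<open>C * v\<close>,
      then makes \<open>u t x\<close> vanish almost surely.\<close>
    have "z \<noteq> 0"
    proof
      assume "z = 0"
      then have "v = 0" using yv \<open>v \<ge> 0\<close> by (smt (verit) y_def zero_le_power2 div_0 power_zero_numeral)
      then have "(Lp_norm P 2 (u t x))\<^sup>2 \<le> 0"
        using moment[of 2] by (simp add: v_def mult_ac)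
      then show False
        using mild_solution_not_AE_0[OF assms(1,5-7), of t x] assms(10)
          AE_eq_0_if_Lp_norm_0[OF meas] by fastforce
    qed
    with \<open>z \<ge> 0\<close> have "z > 0" by simp
    then have "y > 0" using \<open>C > 0\<close> by (simp add: y_def)
    have yM: "y \<ge> 2 * M\<^sup>2" using yv \<open>v \<ge> 0\<close> by simp
    have Cy: "C * y = (z / exp 1)\<^sup>2" using \<open>C > 0\<close> by (simp add: y_def power_divide)
    have tail: "?p \<le> exp (- p)" if "p \<ge> 2" "ennreal (C * p * h) \<le> Ffun \<rho> y" for p
    proof -
      have "C * Finv \<rho> M (C * p * h) \<le> C * y"
        using Finv_le[OF yM that(2)] \<open>C > 0\<close> by simp
      then have "(Lp_norm P p (u t x))\<^sup>2 \<le> ennreal ((z / exp 1)\<^sup>2)"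
        using moment[OF that(1)] unfolding Cy by (meson ennreal_leI order_trans)
      then show ?thesis
        by (rule tail_le_exp_neg_moment_order[OF assms(1) meas that(1) \<open>z > 0\<close>])
    qed
    show ?thesis
    proof (cases "Ffun \<rho> y")
      case (real r)
      \<comment> \<open>The threshold enters through \<open>v \<le> y\<close>. The level
        \<open>2 * C * h\<close> corresponds to order 2, the least order covered by the moment
        bound.\<close>
      have "ennreal (2 * C * h) \<le> Ffun \<rho> y"
        using yv \<open>C > 0\<close> \<open>h > 0\<close> \<open>M \<ge> 0\<close> \<open>y > 0\<close> yM
        by (intro le_Ffun_if_Finv_le[OF assms(3,4)]) (auto simp: v_def[symmetric] intro: order_trans[rotated])
      then have r: "2 * C * h \<le> r" using real by simp
      \<comment> \<open>The order \<open>r / (C * h)\<close> is the largest one allowed in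
        \<open>tail\<close>, since there \<open>C * p * h\<close> equals \<open>r\<close>.\<close>
      have "?p \<le> exp (- (r / (C * h)))"
        using r real \<open>C > 0\<close> \<open>h > 0\<close> by (intro tail) (auto simp: field_simps)
      also have "\<dots> = exp_neg (ennreal (inverse (C * h)) * Ffun \<rho> y)"
        using real \<open>C > 0\<close> \<open>h > 0\<close>
        by (simp add: exp_neg_def ennreal_mult[symmetric] divide_inverse mult.commute)
      finally show ?thesis .
    next
      case top
      \<comment> \<open>For \<open>F(y) = \<infinity>\<close> every order \<open>p \<ge> 2\<close>
        is allowed, so the probability lies below \<open>exp (- p)\<close> for arbitrarily large
        \<open>p\<close>.\<close>
      have "?p \<le> 0"
      proof (rule tendsto_lowerbound)
        show "((\<lambda>p. exp (- p)) \<longlongrightarrow> (0::real)) at_top"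
          by (intro filterlim_compose[OF exp_at_bot]) (simp add: filterlim_uminus_at_bot filterlim_ident)
        show "\<forall>\<^sub>F p in at_top. ?p \<le> exp (- p)"
          using eventually_ge_at_top[of 2] by eventually_elim (rule tail, auto simp: top)
      qed simp
      then show ?thesis
        by (smt (verit) exp_neg_def exp_gt_zero)
    qed
  qed
  then show ?thesis by (simp add: h_def y_def)
qed

end
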